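(* On $\mathcal{H}=L^2(\mathbb{R})$, let $\mathsf{Q}$ and $\mathsf{P}$ be the canonical position and momentum observables with outcome space $\mathbb{R}$, given by $\langle\psi,\mathsf{Q}(X)\psi\rangle=\int_X|\psi(x)|^2\,dx$ and $\langle\psi,\mathsf{P}(Y)\psi\rangle=\int_Y|\widehat{\psi}(y)|^2\,dy$ for Borel sets $X,Y\subseteq\mathbb{R}$, where $\widehat\psi$ is the (unitary) Fourier transform of $\psi$. Then $\mathsf{Q}$ and $\mathsf{P}$ are maximally incompatible, i.e. $J(\mathsf{Q},\mathsf{P})=\{(\lambda,\mu)\in[0,1]^2:\lambda+\mu\leq 1\}$.
   Context: An observable on a Hilbert space $\mathcal{H}$ with outcome space $\Omega$ (a Borel subset of some $\mathbb{R}^n$) is a normalized positive operator valued measure (POVM) on the Borel sets of $\Omega$. An observable $\mathsf{T}$ is trivial if $\mathsf{T}(X)=\mu(X)I$ for some probability measure $\mu$. Two observables $\mathsf{M}_1,\mathsf{M}_2$ with outcome spaces $\Omega_1,\Omega_2$ are jointly measurable if there is an observable $\mathsf{M}$ on $\Omega_1\times\Omega_2$ with $\mathsf{M}(X\times\Omega_2)=\mathsf{M}_1(X)$ and $\mathsf{M}(\Omega_1\times Y)=\mathsf{M}_2(Y)$ for all Borel $X,Y$. The joint measurability region $J(\mathsf{M}_1,\mathsf{M}_2)$ is the set of $(\lambda,\mu)\in[0,1]\times[0,1]$ for which there exist trivial observables $\mathsf{T}_1$ on $\Omega_1$ and $\mathsf{T}_2$ on $\Omega_2$ such that $\lambda\mathsf{M}_1+(1-\lambda)\mathsf{T}_1$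 and $\mu\mathsf{M}_2+(1-\mu)\mathsf{T}_2$ are jointly measurable. A pair is maximally incompatible if its joint measurability region equals $\{(\lambda,\mu)\in[0,1]^2:\lambda+\mu\leq1\}$. *)

theory Defs
  imports "HOL-Probability.Probability"
begin

text \<open>Vectors of H = L^2(R) are represented by square-integrable representatives
  real => complex; vectors are identified up to Lebesgue-a.e. equality.
  Operators are maps on representatives, required to be well defined on classes.\<close>

type_synonym vec = "real \<Rightarrow> complex"
type_synonym lop = "vec \<Rightarrow> vec"

definition L2 :: "vec set" where
  "L2 = {f. f \<in> borel_measurable lborel \<and> integrable lborel (\<lambda>x. (cmod (f x))\<^sup>2)}"

definition ae_eq :: "vec \<Rightarrow> vec \<Rightarrow> bool" where
  "ae_eq f g \<longleftrightarrow> (AE x in lborel. f x = g x)"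

definition ip :: "vec \<Rightarrow> vec \<Rightarrow> complex" where
  "ip f g = (LINT x|lborel. cnj (f x) * g x)"

definition is_operator :: "lop \<Rightarrow> bool" where
  "is_operator T \<longleftrightarrow>
     (\<forall>f\<in>L2. T f \<in> L2) \<and>
     (\<forall>f\<in>L2. \<forall>g\<in>L2. ae_eq f g \<longrightarrow> ae_eq (T f) (T g)) \<and>
     (\<forall>f\<in>L2. \<forall>g\<in>L2. \<forall>a b::complex.
        ae_eq (T (\<lambda>x. a * f x + b * g x)) (\<lambda>x. a * T f x + b * T g x))"

definition op_eq :: "lop \<Rightarrow> lop \<Rightarrow> bool" where
  "op_eq S T \<longleftrightarrow> (\<forall>f\<in>L2. ae_eq (S f) (T f))"

definition povm :: "'a measure \<Rightarrow> ('a set \<Rightarrow> lop) \<Rightarrow> bool" where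
  "povm M E \<longleftrightarrow>
     (\<forall>X\<in>sets M. is_operator (E X) \<and>
        (\<forall>f\<in>L2. Im (ip f (E X f)) = 0 \<and> 0 \<le> Re (ip f (E X f)))) \<and>
     op_eq (E (space M)) id \<and>
     (\<forall>A :: nat \<Rightarrow> 'a set. range A \<subseteq> sets M \<longrightarrow> disjoint_family A \<longrightarrow>
        (\<forall>f\<in>L2. \<forall>g\<in>L2. (\<lambda>n. ip g (E (A n) f)) sums ip g (E (\<Union>n. A n) f)))"

definition is_trivial :: "'a measure \<Rightarrow> ('a set \<Rightarrow> lop) \<Rightarrow> bool" where
  "is_trivial M T \<longleftrightarrow> (\<exists>\<mu>. prob_space \<mu> \<and> sets \<mu> = sets M \<and>
      T = (\<lambda>X f x. complex_of_real (measure \<mu> X) * f x))"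

definition obs_comb :: "real \<Rightarrow> ('a set \<Rightarrow> lop) \<Rightarrow> ('a set \<Rightarrow> lop) \<Rightarrow> ('a set \<Rightarrow> lop)" where
  "obs_comb l E T = (\<lambda>X f x. complex_of_real l * E X f x + complex_of_real (1 - l) * T X f x)"

definition jointly_measurable ::
  "'a measure \<Rightarrow> 'b measure \<Rightarrow> ('a set \<Rightarrow> lop) \<Rightarrow> ('b set \<Rightarrow> lop) \<Rightarrow> bool" where
  "jointly_measurable M1 M2 E1 E2 \<longleftrightarrow>
     (\<exists>E. povm (M1 \<Otimes>\<^sub>M M2) E \<and>
        (\<forall>X\<in>sets M1. op_eq (E (X \<times> space M2)) (E1 X)) \<and>
        (\<forall>Y\<in>sets M2. op_eq (E (space M1 \<times> Y)) (E2 Y)))"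

definition JM_region ::
  "'a measure \<Rightarrow> 'b measure \<Rightarrow> ('a set \<Rightarrow> lop) \<Rightarrow> ('b set \<Rightarrow> lop) \<Rightarrow> (real \<times> real) set" where
  "JM_region M1 M2 E1 E2 = {(l, m). 0 \<le> l \<and> l \<le> 1 \<and> 0 \<le> m \<and> m \<le> 1 \<and>
     (\<exists>T1 T2. is_trivial M1 T1 \<and> is_trivial M2 T2 \<and>
        jointly_measurable M1 M2 (obs_comb l E1 T1) (obs_comb m E2 T2))}"

definition position :: "real set \<Rightarrow> lop" where
  "position X = (\<lambda>f x. indicator X x * f x)"

text \<open>Unitary Fourier transform, given by the integral for integrable psi.\<close>
definition fourier :: "vec \<Rightarrow> vec" where
  "fourier f = (\<lambda>y. (LINT x|lborel. exp (- \<i> * complex_of_real (x * y)) * f x)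
                    / complex_of_real (sqrt (2 * pi)))"

text \<open>P is the canonical momentum observable: a POVM on the Borel sets of R with
  <psi, P(Y) psi> = int_Y |psi^(y)|^2 dy.  The identity is required on the dense
  subspace L^1 \<inter> L^2 (where the Fourier integral converges); this determines P
  uniquely as an operator on L^2.\<close>
definition is_momentum :: "(real set \<Rightarrow> lop) \<Rightarrow> bool" where
  "is_momentum P \<longleftrightarrow> povm (borel :: real measure) P \<and>
     (\<forall>f\<in>L2. integrable lborel f \<longrightarrow> (\<forall>Y\<in>sets borel.
        ip f (P Y f) = complex_of_real (LINT y:Y|lborel. (cmod (fourier f y))\<^sup>2)))"

end

theory Submission
  imports Defs
begin

text \<open>
  If \<open>l + m \<le> 1\<close>, take both noises to be point masses at 0: measuring position with probability \<open>l\<close>,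
  momentum with probability \<open>m\<close>, and reporting 0 for every quantity not measured is a joint
  measurement.

  Conversely, let \<open>E\<close> be a joint observable and let \<open>X\<close>, \<open>Y\<close> be bounded sets so far out that the
  noise gives them mass at most \<open>e\<close>. The effect \<open>G = E (X \<times> Y)\<close> lies below \<open>Q X + e\<close> and below
  \<open>P Y + e\<close>, so in the seminorm \<open>sqrt \<langle>f, G f\<rangle>\<close> replacing \<open>f\<close> by \<open>P Y (Q X f)\<close> costs only
  \<open>2 * sqrt e\<close> times the norm of \<open>f\<close>. If \<open>\<bar>X\<bar> \<bar>Y\<bar> \<le> pi / 2\<close> this replacement halves the norm, and
  iteration gives \<open>G \<le> 16 * e\<close>. A larger box is cut into a number of such boxes that does not depend
  on \<open>e\<close>, so \<open>E (X \<times> Y)\<close> tends to 0 as boxes of a fixed size move to infinity. A wave packet moving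
  along with the boxes has \<open>\<langle>Q X\<rangle> = 1\<close> and \<open>\<langle>P Y\<rangle>\<close> close to 1, and
  \<open>E (X \<times> UNIV) + E (UNIV \<times> Y) \<le> 1 + E (X \<times> Y)\<close> yields \<open>l + m \<le> 1\<close>.

  The only fact about the Fourier transform that is needed is that \<open>P Y\<close> is a projection. It follows
  from the normalisation of \<open>P\<close>, which says that the transform is an isometry on \<open>L1 \<inter> L2\<close>, because
  the inverse transform is the conjugate of the transform.
\<close>

section \<open>Positive operators and their seminorms\<close>

definition positive_op :: "lop \<Rightarrow> bool" where
  "positive_op G \<longleftrightarrow> is_operator G \<and> (\<forall>f\<in>L2. Im (ip f (G f)) = 0 \<and> 0 \<le> Re (ip f (G f)))"

text \<open>For \<open>G = id\<close> this is the squared norm of L2, so the norm and the seminorms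
  of effects share one set of lemmas. For positive \<open>G\<close> the discarded imaginary part is
  0.\<close>

definition qform :: "lop \<Rightarrow> vec \<Rightarrow> real" where
  "qform G f = Re (ip f (G f))"

lemma cnj_borel_measurable [measurable]: "cnj \<in> borel_measurable borel"
  by (intro borel_measurable_continuous_onI continuous_intros)

lemma L2_measurable [measurable_dest]: "f \<in> L2 \<Longrightarrow> f \<in> borel_measurable borel"
  by (simp add: L2_def)

lemma L2_integrable: "f \<in> L2 \<Longrightarrow> integrable lborel (\<lambda>x. (cmod (f x))\<^sup>2)"
  by (simp add: L2_def)

lemma L2_bounded_by:
  assumes "f \<in> L2" "g \<in> borel_measurable borel" "\<And>x. cmod (g x) \<le> cmod (f x)"
  shows "g \<in> L2"
proof -
  have "integrable lborel (\<lambda>x. (cmod (g x))\<^sup>2)"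
    by (rule Bochner_Integration.integrable_bound[OF L2_integrable[OF assms(1)]])
      (use assms in \<open>auto intro!: power_mono\<close>)
  then show ?thesis using assms by (simp add: L2_def)
qed

lemma L2_bounded_support:
  assumes [measurable]: "g \<in> borel_measurable borel" and "A \<in> sets borel" "bounded A"
    and "\<And>x. x \<notin> A \<Longrightarrow> g x = 0" and "\<And>x. cmod (g x) \<le> B"
  shows "g \<in> L2"
proof -
  have "integrable lborel (\<lambda>x. (cmod (g x))\<^sup>2)"
  proof (rule integrableI_bounded_set[where A = A and B = "B\<^sup>2"])
    show "emeasure lborel A < \<infinity>" using emeasure_bounded_finite[OF assms(3)] by simp
  qed (use assms in \<open>auto intro!: power_mono\<close>)
  then show ?thesis by (simp add: L2_def)
qed

lemma L2_ip_integrable: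
  assumes [measurable]: "f \<in> L2" "g \<in> L2"
  shows "integrable lborel (\<lambda>x. cnj (f x) * g x)"
proof (rule Bochner_Integration.integrable_bound)
  show "integrable lborel (\<lambda>x. (cmod (f x))\<^sup>2 + (cmod (g x))\<^sup>2)"
    using assms by (intro Bochner_Integration.integrable_add L2_integrable)
  have "cmod a * cmod b \<le> (cmod a)\<^sup>2 + (cmod b)\<^sup>2" for a b
    using sum_squares_bound[of "cmod a" "cmod b"] mult_nonneg_nonneg[of "cmod a" "cmod b"] norm_ge_zero[of a] norm_ge_zero[of b]
    by linarith
  then show "AE x in lborel. norm (cnj (f x) * g x) \<le> norm ((cmod (f x))\<^sup>2 + (cmod (g x))\<^sup>2)"
    by (simp add: norm_mult)
qed simp

lemma L2_lincomb:
  assumes [measurable]: "f \<in> L2" "g \<in> L2"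
  shows "(\<lambda>x. a * f x + b * g x) \<in> L2"
proof -
  have "integrable lborel (\<lambda>x. (cmod (a * f x + b * g x))\<^sup>2)"
  proof (rule Bochner_Integration.integrable_bound)
    show "integrable lborel (\<lambda>x. 2 * (cmod a)\<^sup>2 * (cmod (f x))\<^sup>2 + 2 * (cmod b)\<^sup>2 * (cmod (g x))\<^sup>2)"
      using assms by (intro Bochner_Integration.integrable_add integrable_mult_right L2_integrable)
    have "(cmod (a * u + b * v))\<^sup>2 \<le> 2 * (cmod a)\<^sup>2 * (cmod u)\<^sup>2 + 2 * (cmod b)\<^sup>2 * (cmod v)\<^sup>2" for u v
    proof -
      have "(cmod (a * u + b * v))\<^sup>2 \<le> (cmod (a * u) + cmod (b * v))\<^sup>2"
        by (intro power_mono norm_triangle_ineq) auto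
      also have "\<dots> \<le> 2 * (cmod (a * u))\<^sup>2 + 2 * (cmod (b * v))\<^sup>2"
        using sum_squares_bound[of "cmod (a * u)" "cmod (b * v)"] by (simp add: power2_sum)
      finally show ?thesis by (simp add: norm_mult power_mult_distrib)
    qed
    then show "AE x in lborel. norm ((cmod (a * f x + b * g x))\<^sup>2) \<le>
        norm (2 * (cmod a)\<^sup>2 * (cmod (f x))\<^sup>2 + 2 * (cmod b)\<^sup>2 * (cmod (g x))\<^sup>2)"
      by simp
  qed simp
  then show ?thesis by (simp add: L2_def)
qed

lemma L2_diff: "f \<in> L2 \<Longrightarrow> g \<in> L2 \<Longrightarrow> (\<lambda>x. f x - g x) \<in> L2"
  using L2_lincomb[of f g 1 "-1"] by simp

lemma ip_cong:
  assumes [measurable]: "f \<in> L2" "f' \<in> L2" "g \<in> L2" "g' \<in> L2" and "ae_eq f f'" "ae_eq g g'"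
  shows "ip f g = ip f' g'"
  unfolding ip_def
proof (rule integral_cong_AE)
  show "AE x in lborel. cnj (f x) * g x = cnj (f' x) * g' x"
    using assms(5,6) unfolding ae_eq_def by eventually_elim simp
qed simp_all

lemma ae_eq_refl [simp]: "ae_eq f f"
  by (simp add: ae_eq_def)

lemma ip_lincomb_right:
  assumes "f \<in> L2" "g \<in> L2" "h \<in> L2"
  shows "ip h (\<lambda>x. a * f x + b * g x) = a * ip h f + b * ip h g"
proof -
  have "ip h (\<lambda>x. a * f x + b * g x) = (LINT x|lborel. a * (cnj (h x) * f x) + b * (cnj (h x) * g x))"
    unfolding ip_def by (simp add: algebra_simps)
  also have "\<dots> = a * ip h f + b * ip h g"
    unfolding ip_def using L2_ip_integrable[of h f] L2_ip_integrable[of h g] assms by simp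
  finally show ?thesis .
qed

lemma ip_cnj: "cnj (ip f g) = ip g f"
  unfolding ip_def by (subst Bochner_Integration.integral_cnj[symmetric]) (simp add: mult.commute)

lemma ip_lincomb_left:
  assumes "f \<in> L2" "g \<in> L2" "h \<in> L2"
  shows "ip (\<lambda>x. a * f x + b * g x) h = cnj a * ip f h + cnj b * ip g h"
  using arg_cong[OF ip_lincomb_right[OF assms, of a b], of cnj] by (simp add: ip_cnj)

lemma ip_self: "ip f f = complex_of_real (LINT x|lborel. (cmod (f x))\<^sup>2)"
proof -
  have "ip f f = (LINT x|lborel. complex_of_real ((cmod (f x))\<^sup>2))"
    unfolding ip_def by (simp add: complex_norm_square mult.commute del: of_real_power)
  then show ?thesis by (simp del: of_real_power)
qed

lemma qform_id: "qform id f = (LINT x|lborel. (cmod (f x))\<^sup>2)"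
  by (simp add: qform_def ip_self)

lemma qform_id_eq_0:
  assumes "f \<in> L2" "qform id f = 0"
  shows "ae_eq f (\<lambda>_. 0)"
  using integral_nonneg_eq_0_iff_AE[OF L2_integrable[OF assms(1)]] assms(2)
  by (simp add: qform_id ae_eq_def)

lemma is_operatorD:
  assumes "is_operator G" "f \<in> L2"
  shows "G f \<in> L2"
  using assms by (simp add: is_operator_def)

lemma positive_opD:
  assumes "positive_op G"
  shows "is_operator G" "f \<in> L2 \<Longrightarrow> G f \<in> L2" "f \<in> L2 \<Longrightarrow> 0 \<le> qform G f"
    "f \<in> L2 \<Longrightarrow> ip f (G f) = complex_of_real (qform G f)"
  using assms by (auto simp: positive_op_def is_operator_def qform_def complex_eq_iff)

lemma positive_op_id: "positive_op id"
  by (auto simp: positive_op_def is_operator_def ip_self ae_eq_def)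

lemma ip_op_lincomb:
  assumes "is_operator G" "f \<in> L2" "g \<in> L2" "h \<in> L2"
  shows "ip h (G (\<lambda>x. a * f x + b * g x)) = a * ip h (G f) + b * ip h (G g)"
proof -
  have "ip h (G (\<lambda>x. a * f x + b * g x)) = ip h (\<lambda>x. a * G f x + b * G g x)"
  proof (rule ip_cong)
    show "ae_eq (G (\<lambda>x. a * f x + b * g x)) (\<lambda>x. a * G f x + b * G g x)"
      using assms unfolding is_operator_def by blast
    show "G (\<lambda>x. a * f x + b * g x) \<in> L2" "(\<lambda>x. a * G f x + b * G g x) \<in> L2"
      using assms by (simp_all add: L2_lincomb is_operatorD[OF assms(1)])
  qed (use assms in simp_all)
  also have "\<dots> = a * ip h (G f) + b * ip h (G g)"
    using assms by (simp add: ip_lincomb_right is_operatorD[OF assms(1)])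
  finally show ?thesis .
qed

text \<open>The complex weight \<open>b\<close> is kept free for polarisation: comparing
  \<open>b = 1\<close> with \<open>b = \<i>\<close> separates the two mixed terms.\<close>

lemma ip_op_quad:
  assumes "is_operator G" "f \<in> L2" "g \<in> L2"
  shows "ip (\<lambda>x. f x + b * g x) (G (\<lambda>x. f x + b * g x)) =
    ip f (G f) + b * ip f (G g) + cnj b * ip g (G f) + cnj b * b * ip g (G g)"
proof -
  note [simp] = is_operatorD[OF assms(1)]
  have L: "(\<lambda>x. f x + b * g x) \<in> L2"
    using L2_lincomb[of f g 1 b] assms by simp
  show ?thesis
    using ip_lincomb_left[of f g "G (\<lambda>x. f x + b * g x)" 1 b]
      ip_op_lincomb[OF assms assms(2), of 1 b] ip_op_lincomb[OF assms assms(3), of 1 b] L assms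
    by (simp add: algebra_simps)
qed

text \<open>The form is real at \<open>f + g\<close> and at \<open>f + \<i> * g\<close>; the first
  fact matches the imaginary parts of the mixed terms, the second their real parts.\<close>

lemma positive_op_hermitian:
  assumes G: "positive_op G" and f: "f \<in> L2" and g: "g \<in> L2"
  shows "ip g (G f) = cnj (ip f (G g))"
proof -
  have z: "Im (ip (\<lambda>x. f x + b * g x) (G (\<lambda>x. f x + b * g x))) = 0" for b
    using G L2_lincomb[OF f g, of 1 b] by (simp add: positive_op_def)
  have "Im (ip f (G f)) = 0" "Im (ip g (G g)) = 0"
    using assms by (auto simp: positive_op_def)
  then show ?thesis
    using z[of 1] z[of \<i>] ip_op_quad[OF positive_opD(1)[OF G] f g, of 1]
      ip_op_quad[OF positive_opD(1)[OF G] f g, of \<i>]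
    by (simp add: complex_eq_iff)
qed

lemma qform_add:
  assumes G: "positive_op G" and f: "f \<in> L2" and g: "g \<in> L2"
  shows "qform G (\<lambda>x. f x + complex_of_real t * g x) = qform G f + 2 * t * Re (ip f (G g)) + t\<^sup>2 * qform G g"
  using ip_op_quad[OF positive_opD(1)[OF G] f g, of "complex_of_real t"] positive_op_hermitian[OF assms]
  by (simp add: qform_def power2_eq_square)

text \<open>Discriminant bound for the polynomial in \<open>t\<close> given by
  \<open>qform_add\<close>, which is never negative. The real part is what the triangle inequality
  uses.\<close>

lemma qform_Cauchy_Schwarz:
  assumes G: "positive_op G" and f: "f \<in> L2" and g: "g \<in> L2"
  shows "(Re (ip f (G g)))\<^sup>2 \<le> qform G f * qform G g"
proof -
  define B where "B = Re (ip f (G g))"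
  have nn: "0 \<le> qform G f + 2 * t * B + t\<^sup>2 * qform G g" for t
    using qform_add[OF assms, of t] positive_opD(3)[OF G L2_lincomb[OF f g, of 1 "complex_of_real t"]]
    by (simp add: B_def)
  have g0: "0 \<le> qform G g" using positive_opD(3)[OF G g] .
  show ?thesis
  proof (cases "qform G g = 0")
    case True
    have "B = 0"
    proof (rule ccontr)
      assume "B \<noteq> 0"
      \<comment> \<open>With leading coefficient 0 the polynomial is affine, and this
        \<open>t\<close> gives it the value -1.\<close>
      then show False using nn[of "- (qform G f + 1) / (2 * B)"] True by (simp add: field_simps)
    qed
    then show ?thesis using True by (simp add: B_def)
  next
    case False
    \<comment> \<open>Evaluation at the minimiser of the polynomial.\<close>
    then show ?thesis using nn[of "- B / qform G g"] g0
      by (simp add: B_def field_simps power2_eq_square)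
  qed
qed

lemma qform_triangle:
  assumes G: "positive_op G" and f: "f \<in> L2" and g: "g \<in> L2"
  shows "sqrt (qform G (\<lambda>x. f x + g x)) \<le> sqrt (qform G f) + sqrt (qform G g)"
proof (rule real_le_lsqrt)
  have nn: "0 \<le> qform G f" "0 \<le> qform G g" using positive_opD(3)[OF G] f g by auto
  then show "0 \<le> sqrt (qform G f) + sqrt (qform G g)" by simp
  have "Re (ip f (G g)) \<le> sqrt (qform G f * qform G g)"
    by (rule real_le_rsqrt[OF qform_Cauchy_Schwarz[OF assms]])
  then show "qform G (\<lambda>x. f x + g x) \<le> (sqrt (qform G f) + sqrt (qform G g))\<^sup>2"
    using qform_add[OF assms, of 1] nn by (simp add: power2_sum real_sqrt_mult)
qed

section \<open>Positive operator valued measures\<close>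

lemma povmD:
  assumes "povm M E"
  shows "X \<in> sets M \<Longrightarrow> positive_op (E X)"
    and "f \<in> L2 \<Longrightarrow> ae_eq (E (space M) f) f"
    and "\<lbrakk>range A \<subseteq> sets M; disjoint_family A; f \<in> L2; g \<in> L2\<rbrakk> \<Longrightarrow>
           (\<lambda>n. ip g (E (A n) f)) sums ip g (E (\<Union>n. A n) f)"
  using assms by (simp_all add: povm_def positive_op_def op_eq_def)

lemma povmI:
  assumes "\<And>X. X \<in> sets M \<Longrightarrow> positive_op (E X)"
    and "\<And>f. f \<in> L2 \<Longrightarrow> ae_eq (E (space M) f) f"
    and "\<And>A f g. \<lbrakk>range A \<subseteq> sets M; disjoint_family A; f \<in> L2; g \<in> L2\<rbrakk> \<Longrightarrow>
           (\<lambda>n. ip g (E (A n) f)) sums ip g (E (\<Union>n. A n) f)"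
  shows "povm M E"
  using assms by (simp add: povm_def positive_op_def op_eq_def)

lemma povm_op_L2:
  assumes "povm M E" "X \<in> sets M" "f \<in> L2"
  shows "E X f \<in> L2"
  by (rule positive_opD(2)[OF povmD(1)[OF assms(1,2)] assms(3)])

text \<open>With every set of the sequence empty, additivity makes a constant series converge, so
  its term is 0.\<close>

lemma povm_ip_empty:
  assumes "povm M E" "f \<in> L2" "g \<in> L2"
  shows "ip g (E {} f) = 0"
proof -
  have "(\<lambda>n::nat. ip g (E {} f)) sums ip g (E (\<Union>n::nat. {}) f)"
    using assms by (intro povmD(3)[OF assms(1)]) (auto simp: disjoint_family_on_def)
  then have "(\<lambda>n::nat. ip g (E {} f)) \<longlonglongrightarrow> 0"
    by (intro summable_LIMSEQ_zero) (rule sums_summable)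
  then show ?thesis by (simp add: LIMSEQ_const_iff)
qed

lemma povm_empty:
  assumes "povm M E" "f \<in> L2"
  shows "ae_eq (E {} f) (\<lambda>_. 0)"
proof (rule qform_id_eq_0)
  show L: "E {} f \<in> L2" using povm_op_L2[OF assms(1) _ assms(2)] by simp
  show "qform id (E {} f) = 0" using povm_ip_empty[OF assms L] by (simp add: qform_def)
qed

text \<open>The unnormalised distribution of outcomes in the state \<open>f\<close>. Monotonicity,
  subadditivity and continuity of effects are read off from it as facts about finite
  measures.\<close>

definition povm_measure :: "'a measure \<Rightarrow> ('a set \<Rightarrow> lop) \<Rightarrow> vec \<Rightarrow> 'a measure" where
  "povm_measure M E f = measure_of (space M) (sets M) (\<lambda>X. ennreal (qform (E X) f))"

lemma povm_measure:
  assumes E: "povm M E" and f: "f \<in> L2"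
  shows "sets (povm_measure M E f) = sets M" "space (povm_measure M E f) = space M"
    and "X \<in> sets M \<Longrightarrow> measure (povm_measure M E f) X = qform (E X) f"
    and "finite_measure (povm_measure M E f)"
    and "measure (povm_measure M E f) (space M) = qform id f"
proof -
  let ?N = "povm_measure M E f"
  show s: "sets ?N = sets M" "space ?N = space M"
    by (simp_all add: povm_measure_def)
  have em: "emeasure ?N X = ennreal (qform (E X) f)" if "X \<in> sets M" for X
    unfolding povm_measure_def
  proof (rule emeasure_measure_of_sigma)
    show "sigma_algebra (space M) (sets M)" by (rule sets.sigma_algebra_axioms)
    show "positive (sets M) (\<lambda>X. ennreal (qform (E X) f))"
      using povm_ip_empty[OF E f f] by (simp add: positive_def qform_def)
    show "countably_additive (sets M) (\<lambda>X. ennreal (qform (E X) f))"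
    proof (rule countably_additiveI)
      fix A :: "nat \<Rightarrow> 'a set"
      assume A: "range A \<subseteq> sets M" "disjoint_family A"
      have "(\<lambda>n. qform (E (A n)) f) sums qform (E (\<Union>n. A n)) f"
        unfolding qform_def by (rule sums_Re[OF povmD(3)[OF E A f f]])
      then show "(\<Sum>n. ennreal (qform (E (A n)) f)) = ennreal (qform (E (\<Union>n. A n)) f)"
        using A by (intro suminf_ennreal_eq positive_opD(3)[OF povmD(1)[OF E]] f) auto
    qed
  qed (rule that)
  show m: "measure ?N X = qform (E X) f" if "X \<in> sets M" for X
    using em[OF that] positive_opD(3)[OF povmD(1)[OF E that] f] by (simp add: measure_def)
  show "finite_measure ?N"
    by (rule finite_measureI) (simp add: s em)
  have "ip f (E (space M) f) = ip f f"
    by (intro ip_cong f povmD(2)[OF E] povm_op_L2[OF E] ae_eq_refl) simp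
  then show "measure ?N (space M) = qform id f"
    by (simp add: m qform_def)
qed

lemma povm_qform_mono:
  assumes E: "povm M E" and f: "f \<in> L2" and "X \<subseteq> Y" "X \<in> sets M" "Y \<in> sets M"
  shows "qform (E X) f \<le> qform (E Y) f"
proof -
  interpret finite_measure "povm_measure M E f" by (rule povm_measure(4)[OF E f])
  show ?thesis
    using finite_measure_mono[of X Y] assms by (simp add: povm_measure[OF E f])
qed

lemma povm_qform_le:
  assumes E: "povm M E" and f: "f \<in> L2" and X: "X \<in> sets M"
  shows "qform (E X) f \<le> qform id f"
proof -
  interpret finite_measure "povm_measure M E f" by (rule povm_measure(4)[OF E f])
  show ?thesis
    using bounded_measure[of X] povm_measure[OF E f] X by simp
qed

text \<open>The mass of \<open>X \<union> Y\<close> is at most the total mass. This is how a small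
  joint effect limits the sharpness of both marginals at once.\<close>

lemma povm_qform_incl_excl:
  assumes E: "povm M E" and f: "f \<in> L2" and X: "X \<in> sets M" and Y: "Y \<in> sets M"
  shows "qform (E X) f + qform (E Y) f \<le> qform id f + qform (E (X \<inter> Y)) f"
proof -
  interpret finite_measure "povm_measure M E f" by (rule povm_measure(4)[OF E f])
  have "measure (povm_measure M E f) (X \<union> Y) = qform (E X) f + qform (E Y) f - qform (E (X \<inter> Y)) f"
    using measure_Un3[of X "povm_measure M E f" Y] X Y
    by (simp add: povm_measure[OF E f] fmeasurable_eq_sets)
  then show ?thesis
    using bounded_measure[of "X \<union> Y"] povm_measure(2,5)[OF E f] by simp
qed

lemma povm_qform_subadditive:
  assumes E: "povm M E" and f: "f \<in> L2" and "finite I" "\<And>i. i \<in> I \<Longrightarrow> A i \<in> sets M"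
    and X: "X \<in> sets M" "X \<subseteq> (\<Union>i\<in>I. A i)"
  shows "qform (E X) f \<le> (\<Sum>i\<in>I. qform (E (A i)) f)"
proof -
  interpret finite_measure "povm_measure M E f" by (rule povm_measure(4)[OF E f])
  have "measure (povm_measure M E f) (\<Union>i\<in>I. A i) \<le> (\<Sum>i\<in>I. measure (povm_measure M E f) (A i))"
    using assms by (intro finite_measure_subadditive_finite) (auto simp: povm_measure[OF E f])
  moreover have U: "(\<Union>i\<in>I. A i) \<in> sets M" using assms by auto
  ultimately show ?thesis
    using assms povm_qform_mono[OF E f X(2,1) U] by (simp add: povm_measure[OF E f])
qed

section \<open>Position\<close>

lemma position_L2:
  assumes "X \<in> sets borel" and [measurable]: "f \<in> L2"
  shows "position X f \<in> L2"
proof -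
  have [measurable]: "X \<in> sets borel" by fact
  show ?thesis unfolding position_def
    by (rule L2_bounded_by[OF assms(2)]) (auto simp: norm_mult indicator_def)
qed

lemma ip_position: "ip g (position X f) = (LINT x:X|lborel. cnj (g x) * f x)"
  unfolding ip_def position_def set_lebesgue_integral_def
  by (intro Bochner_Integration.integral_cong) (auto simp: indicator_def)

lemma ip_position_self: "ip f (position X f) = complex_of_real (LINT x:X|lborel. (cmod (f x))\<^sup>2)"
proof -
  have "ip f (position X f) = (LINT x:X|lborel. complex_of_real ((cmod (f x))\<^sup>2))"
    unfolding ip_position set_lebesgue_integral_def
    by (intro Bochner_Integration.integral_cong refl) (simp add: complex_norm_square mult.commute del: of_real_power)
  then show ?thesis
    by (simp only: set_integral_complex_of_real)
qed

lemma qform_position: "qform (position X) f = (LINT x:X|lborel. (cmod (f x))\<^sup>2)"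
  by (simp add: qform_def ip_position_self)

lemma is_operator_position:
  assumes "X \<in> sets borel"
  shows "is_operator (position X)"
  unfolding is_operator_def
proof (intro conjI ballI allI impI)
  fix f g :: vec assume "ae_eq f g"
  then show "ae_eq (position X f) (position X g)"
    unfolding ae_eq_def position_def by eventually_elim simp
qed (use position_L2[OF assms] in \<open>auto simp: ae_eq_def position_def algebra_simps\<close>)

lemma positive_op_position:
  assumes "X \<in> sets borel"
  shows "positive_op (position X)"
  unfolding positive_op_def
  using is_operator_position[OF assms] by (auto simp: ip_position_self set_lebesgue_integral_def)

text \<open>Countable additivity is continuity of the integral along increasing partial unions; the
  integrand is integrable on the full union, being a product of two L2 functions.\<close>

lemma povm_position: "povm borel position"
proof (rule povmI)
  fix A :: "nat \<Rightarrow> real set" and f g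
  assume A: "range A \<subseteq> sets borel" "disjoint_family A" and fg: "f \<in> L2" "g \<in> L2"
  have "set_integrable lborel (\<Union>n. A n) (\<lambda>x. cnj (g x) * f x)"
    unfolding set_integrable_def using A
    by (intro integrable_mult_indicator L2_ip_integrable fg) auto
  then have int: "set_integrable lborel (\<Union>n. \<Union>i<n. A i) (\<lambda>x. cnj (g x) * f x)"
    by (rule set_integrable_subset) (use A in auto)
  have "(\<lambda>n. LINT x:(\<Union>i<n. A i)|lborel. cnj (g x) * f x) \<longlonglongrightarrow>
      (LINT x:(\<Union>n. \<Union>i<n. A i)|lborel. cnj (g x) * f x)"
  proof (rule set_integral_cont_up[OF _ _ int])
    show "(\<Union>i<n. A i) \<in> sets lborel" for n using A by auto
    show "incseq (\<lambda>n. \<Union>i<n. A i)" by (rule incseq_SucI) (auto simp: less_Suc_eq)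
  qed
  moreover have "(\<Union>n. \<Union>i<n. A i) = (\<Union>n. A n)" by auto
  moreover have "(LINT x:(\<Union>i<n. A i)|lborel. cnj (g x) * f x) = (\<Sum>i<n. LINT x:A i|lborel. cnj (g x) * f x)" for n
  proof (rule set_integral_finite_Union)
    show "disjoint_family_on A {..<n}" using A(2) by (rule disjoint_family_on_mono[rotated]) simp
    show "set_integrable lborel (A i) (\<lambda>x. cnj (g x) * f x)" for i
      by (rule set_integrable_subset[OF int]) (use A in auto)
    show "A i \<in> sets lborel" for i using A by auto
  qed simp
  ultimately show "(\<lambda>n. ip g (position (A n) f)) sums ip g (position (\<Union>n. A n) f)"
    by (simp add: ip_position sums_def)
next
  show "ae_eq (position (space borel) f) f" for f by (simp add: position_def)
qed (rule positive_op_position)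

section \<open>Mixtures and joint measurability\<close>

lemma is_operator_lincomb:
  assumes S: "is_operator S" and T: "is_operator T"
  shows "is_operator (\<lambda>f x. a * S f x + b * T f x)"
  unfolding is_operator_def
proof (intro conjI ballI allI impI)
  fix f g :: vec and c d assume fg: "f \<in> L2" "g \<in> L2"
  have "ae_eq (S (\<lambda>x. c * f x + d * g x)) (\<lambda>x. c * S f x + d * S g x)"
    "ae_eq (T (\<lambda>x. c * f x + d * g x)) (\<lambda>x. c * T f x + d * T g x)"
    using S T fg unfolding is_operator_def by blast+
  then show "ae_eq (\<lambda>x. a * S (\<lambda>x. c * f x + d * g x) x + b * T (\<lambda>x. c * f x + d * g x) x)
      (\<lambda>x. c * (a * S f x + b * T f x) + d * (a * S g x + b * T g x))"
    unfolding ae_eq_def by eventually_elim (simp add: algebra_simps)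
  assume "ae_eq f g"
  then have "ae_eq (S f) (S g)" "ae_eq (T f) (T g)"
    using S T fg unfolding is_operator_def by blast+
  then show "ae_eq (\<lambda>x. a * S f x + b * T f x) (\<lambda>x. a * S g x + b * T g x)"
    unfolding ae_eq_def by eventually_elim simp
next
  fix f assume "f \<in> L2"
  then show "(\<lambda>x. a * S f x + b * T f x) \<in> L2"
    by (intro L2_lincomb is_operatorD[OF S] is_operatorD[OF T])
qed

lemma obs_comb_ip:
  assumes "povm M E" "povm M F" "X \<in> sets M" "f \<in> L2" "g \<in> L2"
  shows "ip g (obs_comb l E F X f) = complex_of_real l * ip g (E X f) + complex_of_real (1 - l) * ip g (F X f)"
  unfolding obs_comb_def
  by (rule ip_lincomb_right[OF povm_op_L2[OF assms(1,3,4)] povm_op_L2[OF assms(2,3,4)] assms(5)])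

lemma povm_obs_comb:
  assumes E: "povm M E" and F: "povm M F" and l: "0 \<le> l" "l \<le> 1"
  shows "povm M (obs_comb l E F)"
proof (rule povmI)
  fix X assume X: "X \<in> sets M"
  note p = povmD(1)[OF E X] povmD(1)[OF F X]
  show "positive_op (obs_comb l E F X)"
    unfolding positive_op_def
  proof (intro conjI ballI)
    show "is_operator (obs_comb l E F X)"
      unfolding obs_comb_def by (intro is_operator_lincomb positive_opD p)
    fix f assume f: "f \<in> L2"
    show "Im (ip f (obs_comb l E F X f)) = 0" "0 \<le> Re (ip f (obs_comb l E F X f))"
      unfolding obs_comb_ip[OF E F X f f] using p[THEN positive_opD(4)] p[THEN positive_opD(3)] f l
      by simp_all
  qed
next
  fix f assume f: "f \<in> L2"
  show "ae_eq (obs_comb l E F (space M) f) f"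
    using povmD(2)[OF E f] povmD(2)[OF F f]
    unfolding ae_eq_def obs_comb_def by eventually_elim (simp add: algebra_simps)
next
  fix A :: "nat \<Rightarrow> 'a set" and f g
  assume A: "range A \<subseteq> sets M" "disjoint_family A" and fg: "f \<in> L2" "g \<in> L2"
  then have "A n \<in> sets M" "(\<Union>n. A n) \<in> sets M" for n by auto
  then show "(\<lambda>n. ip g (obs_comb l E F (A n) f)) sums ip g (obs_comb l E F (\<Union>n. A n) f)"
    by (simp only: obs_comb_ip[OF E F _ fg])
      (intro sums_add sums_mult povmD(3)[OF E A fg] povmD(3)[OF F A fg])
qed

lemma povm_trivial:
  assumes "is_trivial M T"
  shows "povm M T"
proof -
  obtain \<mu> where \<mu>: "prob_space \<mu>" and s: "sets \<mu> = sets M"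
    and T: "T = (\<lambda>X f x. complex_of_real (measure \<mu> X) * f x)"
    using assms unfolding is_trivial_def by blast
  interpret prob_space \<mu> by (rule \<mu>)
  have ip: "ip g (T X f) = complex_of_real (measure \<mu> X) * ip g f" for g X f
  proof -
    have "ip g (T X f) = (LINT x|lborel. complex_of_real (measure \<mu> X) * (cnj (g x) * f x))"
      unfolding T ip_def by (simp add: mult.left_commute)
    then show ?thesis by (simp add: ip_def)
  qed
  show ?thesis
  proof (rule povmI)
    fix X
    \<comment> \<open>The summand of weight 0 only serves to present a scalar multiple as a linear
      combination.\<close>
    have "is_operator (\<lambda>f x. complex_of_real (measure \<mu> X) * id f x + 0 * id f x)"
      by (intro is_operator_lincomb positive_opD(1) positive_op_id)
    then show "positive_op (T X)"
      by (simp add: positive_op_def ip) (simp add: T ip_self)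
  next
    fix f
    show "ae_eq (T (space M) f) f"
      using prob_space sets_eq_imp_space_eq[OF s] by (simp add: T)
  next
    fix A :: "nat \<Rightarrow> 'a set" and f g
    assume A: "range A \<subseteq> sets M" "disjoint_family A"
    show "(\<lambda>n. ip g (T (A n) f)) sums ip g (T (\<Union>n. A n) f)"
      unfolding ip using A s
      by (intro sums_mult2 sums_of_real finite_measure_UNION) auto
  qed
qed

text \<open>Relabelling of outcomes by \<open>h\<close>. The embeddings of the line as the two axes
  of the plane will turn \<open>position\<close> and \<open>P\<close> into observables of
  pairs.\<close>

lemma povm_pushforward:
  assumes E: "povm M E" and h: "h \<in> measurable M N"
  shows "povm N (\<lambda>Z. E (h -` Z \<inter> space M))"
proof (rule povmI)
  fix A :: "nat \<Rightarrow> 'b set" and f g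
  assume A: "range A \<subseteq> sets N" "disjoint_family A" and fg: "f \<in> L2" "g \<in> L2"
  have "(\<lambda>n. ip g (E (h -` A n \<inter> space M) f)) sums ip g (E (\<Union>n. h -` A n \<inter> space M) f)"
    using A measurable_sets[OF h] by (intro povmD(3)[OF E _ _ fg]) (auto simp: disjoint_family_on_def)
  then show "(\<lambda>n. ip g (E (h -` A n \<inter> space M) f)) sums ip g (E (h -` (\<Union>n. A n) \<inter> space M) f)"
    by (simp add: vimage_UN)
next
  fix f assume f: "f \<in> L2"
  have "h -` space N \<inter> space M = space M" using measurable_space[OF h] by auto
  then show "ae_eq (E (h -` space N \<inter> space M) f) f" using povmD(2)[OF E f] by simp
qed (intro povmD(1)[OF E] measurable_sets[OF h])

section \<open>The joint observable for \<open>l + m \<le> 1\<close>\<close>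

lemma is_trivial_return:
  "x \<in> space M \<Longrightarrow> is_trivial M (\<lambda>X f y. complex_of_real (measure (return M x) X) * f y)"
  unfolding is_trivial_def by (intro exI[of _ "return M x"]) (simp add: prob_space_return)

lemma JM_region_if_sum_le_1:
  fixes P :: "real set \<Rightarrow> lop"
  assumes P: "povm borel P" and "0 \<le> l" "0 \<le> m" "l + m \<le> 1"
  shows "(l, m) \<in> JM_region borel borel position P"
proof -
  define T :: "real set \<Rightarrow> lop" where "T = (\<lambda>X f y. complex_of_real (measure (return borel 0) X) * f y)"
  define T' :: "(real \<times> real) set \<Rightarrow> lop"
    where "T' = (\<lambda>X f y. complex_of_real (measure (return (borel \<Otimes>\<^sub>M borel) (0, 0)) X) * f y)"
  define E1 :: "(real \<times> real) set \<Rightarrow> lop" where "E1 Z = position ((\<lambda>x. (x, 0)) -` Z \<inter> space borel)" for Z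
  define E2 :: "(real \<times> real) set \<Rightarrow> lop" where "E2 Z = P ((\<lambda>y. (0, y)) -` Z \<inter> space borel)" for Z
  \<comment> \<open>The nesting produces a mixture of three terms with weights \<open>l\<close>,
    \<open>m\<close> and \<open>1 - l - m\<close>.\<close>
  define E where "E = obs_comb l E1 (obs_comb (m / (1 - l)) E2 T')"
  have T: "is_trivial borel T" unfolding T_def by (rule is_trivial_return) simp
  \<comment> \<open>If \<open>l = 1\<close> then \<open>m = 0\<close>, and division by zero yields
    0, which fits all three claims.\<close>
  have m: "0 \<le> m / (1 - l)" "m / (1 - l) \<le> 1" "(1 - l) * (m / (1 - l)) = m"
    using assms by (cases "l = 1"; simp add: field_simps)+
  have E: "povm (borel \<Otimes>\<^sub>M borel) E"
    unfolding E_def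
  proof (intro povm_obs_comb m)
    show "povm (borel \<Otimes>\<^sub>M borel) E1" unfolding E1_def[abs_def]
      by (rule povm_pushforward[OF povm_position]) measurable
    show "povm (borel \<Otimes>\<^sub>M borel) E2" unfolding E2_def[abs_def]
      by (rule povm_pushforward[OF P]) measurable
    show "povm (borel \<Otimes>\<^sub>M borel) T'" unfolding T'_def
      by (rule povm_trivial[OF is_trivial_return]) (simp add: space_pair_measure)
  qed (use assms in auto)
  have w: "complex_of_real (1 - l) * (complex_of_real (m / (1 - l)) * u + complex_of_real (1 - m / (1 - l)) * v)
      = complex_of_real m * u + complex_of_real (1 - l - m) * v" for u v
  proof -
    have "complex_of_real (1 - l) * (complex_of_real (m / (1 - l)) * u + complex_of_real (1 - m / (1 - l)) * v)
      = complex_of_real ((1 - l) * (m / (1 - l))) * u + complex_of_real ((1 - l) - (1 - l) * (m / (1 - l))) * v"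
      by (simp add: algebra_simps)
    then show ?thesis unfolding m(3) .
  qed
  have Edec: "E Z f x = complex_of_real l * E1 Z f x +
      (complex_of_real m * E2 Z f x + complex_of_real (1 - l - m) * T' Z f x)" for Z f x
    unfolding E_def obs_comb_def w ..
  have tm: "measure (return borel 0) X = indicator X (0::real)" if "X \<in> sets borel" for X
    using that by (simp add: measure_return)
  have tm': "measure (return (borel \<Otimes>\<^sub>M borel) (0, 0)) (X \<times> Y) = indicator X (0::real) * indicator Y (0::real)"
    if "X \<in> sets borel" "Y \<in> sets borel" for X Y
    using that by (simp add: measure_return indicator_times)
  \<comment> \<open>The momentum part of \<open>E (X \<times> space borel)\<close> is
    \<open>P UNIV\<close> or \<open>P {}\<close> according to whether 0 lies in \<open>X\<close>;
    both are known only up to a.e. equality.\<close>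
  have P1: "AE x in lborel. P UNIV f x = f x" "AE x in lborel. P {} f x = 0" if "f \<in> L2" for f
    using povmD(2)[OF P that] povm_empty[OF P that] by (simp_all add: ae_eq_def)
  have "op_eq (E (X \<times> space borel)) (obs_comb l position T X)" if "X \<in> sets borel" for X
    unfolding op_eq_def ae_eq_def
  proof
    fix f assume f: "f \<in> L2"
    show "AE x in lborel. E (X \<times> space borel) f x = obs_comb l position T X f x"
      using P1[OF f] by eventually_elim (use that in \<open>auto simp: Edec E1_def E2_def obs_comb_def T_def T'_def tm tm' indicator_def algebra_simps\<close>)
  qed
  moreover have "op_eq (E (space borel \<times> Y)) (obs_comb m P T Y)" if "Y \<in> sets borel" for Y
    unfolding op_eq_def ae_eq_def
  proof
    fix f assume f: "f \<in> L2"
    show "AE x in lborel. E (space borel \<times> Y) f x = obs_comb m P T Y f x"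
      using P1[OF f] by eventually_elim (use that in \<open>auto simp: Edec E1_def E2_def obs_comb_def T_def T'_def tm tm' position_def indicator_def algebra_simps\<close>)
  qed
  ultimately have "jointly_measurable borel borel (obs_comb l position T) (obs_comb m P T)"
    unfolding jointly_measurable_def using E by blast
  then show ?thesis using T assms unfolding JM_region_def by auto
qed

section \<open>Fourier transform and momentum\<close>

text \<open>A product of two L2 functions, \<open>f\<close> and the indicator of \<open>X\<close>.
  Truncated vectors thus lie in L1 and L2, where the Fourier formula for \<open>P\<close>
  applies.\<close>

lemma L2_position_integrable:
  assumes [measurable]: "X \<in> sets borel" and X: "bounded X" and f: "f \<in> L2"
  shows "integrable lborel (position X f)"
proof -
  have "(indicator X :: vec) \<in> L2"
    by (rule L2_bounded_support[of _ X 1]) (use X in \<open>auto simp: indicator_def\<close>)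
  from L2_ip_integrable[OF this f] show ?thesis
    by (rule Bochner_Integration.integrable_cong[THEN iffD1, rotated -1]) (auto simp: position_def indicator_def)
qed

lemma fourier_kernel_integrable:
  assumes "integrable lborel f"
  shows "integrable lborel (\<lambda>x. exp (- \<i> * complex_of_real (x * y)) * f x)"
proof -
  have [measurable]: "f \<in> borel_measurable borel" using assms by auto
  show ?thesis
    by (rule Bochner_Integration.integrable_bound[OF assms]) (auto simp: norm_mult)
qed

lemma fourier_measurable [measurable]:
  assumes [measurable]: "f \<in> borel_measurable borel"
  shows "fourier f \<in> borel_measurable borel"
  unfolding fourier_def by measurable

lemma fourier_lincomb:
  assumes "integrable lborel f" "integrable lborel g"
  shows "fourier (\<lambda>x. f x + b * g x) y = fourier f y + b * fourier g y"
proof -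
  have "(LINT x|lborel. exp (- \<i> * complex_of_real (x * y)) * (f x + b * g x)) =
    (LINT x|lborel. exp (- \<i> * complex_of_real (x * y)) * f x + b * (exp (- \<i> * complex_of_real (x * y)) * g x))"
    by (simp add: algebra_simps)
  also have "\<dots> = (LINT x|lborel. exp (- \<i> * complex_of_real (x * y)) * f x) +
      b * (LINT x|lborel. exp (- \<i> * complex_of_real (x * y)) * g x)"
    using fourier_kernel_integrable[OF assms(1)] fourier_kernel_integrable[OF assms(2)] by simp
  finally show ?thesis by (simp add: fourier_def add_divide_distrib)
qed

lemma fourier_bound:
  assumes "integrable lborel f"
  shows "cmod (fourier f y) \<le> (LINT x|lborel. cmod (f x)) / sqrt (2 * pi)"
proof -
  have "cmod (LINT x|lborel. exp (- \<i> * complex_of_real (x * y)) * f x) \<le> (LINT x|lborel. cmod (f x))"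
    using integral_norm_bound[of lborel "\<lambda>x. exp (- \<i> * complex_of_real (x * y)) * f x"]
    by (simp add: norm_mult)
  then show ?thesis
    by (simp add: fourier_def norm_divide divide_right_mono)
qed

text \<open>Fubini, with a kernel symmetric in its two variables: the transform is its own
  transpose, so its adjoint is \<open>cnj\<close> of the transform of \<open>cnj\<close>.\<close>

lemma fourier_multiplication_formula:
  assumes f: "integrable lborel f" and g: "integrable lborel g"
  shows "(LINT y|lborel. fourier f y * g y) = (LINT x|lborel. f x * fourier g x)"
proof -
  have [measurable]: "f \<in> borel_measurable borel" "g \<in> borel_measurable borel"
    using f g by auto
  define K :: "real \<Rightarrow> real \<Rightarrow> complex" where "K x y = exp (- \<i> * complex_of_real (x * y)) * f x * g y" for x y
  have [measurable]: "case_prod K \<in> borel_measurable (lborel \<Otimes>\<^sub>M lborel)"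
    unfolding K_def[abs_def] by simp
  have nK: "norm (K x y) = cmod (f x) * cmod (g y)" for x y
    by (simp add: K_def norm_mult)
  have "integrable (lborel \<Otimes>\<^sub>M lborel) (case_prod K)"
  proof (rule lborel_pair.Fubini_integrable)
    show "AE x in lborel. integrable lborel (\<lambda>y. case_prod K (x, y))"
    proof (rule AE_I2)
      fix x
      have "integrable lborel (\<lambda>y. f x * (exp (- \<i> * complex_of_real (y * x)) * g y))"
        by (intro integrable_mult_right fourier_kernel_integrable g)
      then show "integrable lborel (\<lambda>y. case_prod K (x, y))"
        by (simp add: K_def mult_ac)
    qed
  qed (use f g in \<open>simp_all add: nK\<close>)
  from lborel_pair.Fubini_integral[OF this]
  have "(LINT y|lborel. LINT x|lborel. K x y) = (LINT x|lborel. LINT y|lborel. K x y)" .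
  moreover have "(LINT x|lborel. K x y) = complex_of_real (sqrt (2 * pi)) * (fourier f y * g y)" for y
    by (simp add: K_def fourier_def)
  moreover have "(LINT y|lborel. K x y) = complex_of_real (sqrt (2 * pi)) * (f x * fourier g x)" for x
  proof -
    have "(LINT y|lborel. K x y) = (LINT y|lborel. f x * (exp (- \<i> * complex_of_real (y * x)) * g y))"
      by (simp add: K_def mult_ac)
    then show ?thesis by (simp add: fourier_def)
  qed
  ultimately show ?thesis by simp
qed

text \<open>The transform of an integrable function is bounded, and a bounded function cut off to a
  bounded set is square integrable.\<close>

lemma position_fourier_L2:
  assumes [measurable]: "Y \<in> sets borel" and Y: "bounded Y" and h: "integrable lborel h"
  shows "position Y (fourier h) \<in> L2"
proof (rule L2_bounded_support)
  have [measurable]: "h \<in> borel_measurable borel" using h by auto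
  show "position Y (fourier h) \<in> borel_measurable borel" unfolding position_def by measurable
  fix x show "cmod (position Y (fourier h) x) \<le> (LINT x|lborel. cmod (h x)) / sqrt (2 * pi)"
    using fourier_bound[OF h, of x] by (auto simp: position_def indicator_def intro: order_trans[OF norm_ge_zero])
qed (use assms in \<open>auto simp: position_def\<close>)

lemma ip_position_position: "ip (position X f) (position X g) = ip (position X f) g"
  unfolding ip_def position_def by (intro Bochner_Integration.integral_cong refl) (auto simp: indicator_def)

lemma ip_position_left: "ip (position X f) g = ip f (position X g)"
  unfolding ip_def position_def by (intro Bochner_Integration.integral_cong refl) (auto simp: indicator_def)

section \<open>Momentum as a projection\<close>

context
  fixes P :: "real set \<Rightarrow> lop"
  assumes P: "is_momentum P"
begin

lemma povm_momentum: "povm borel P"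
  using P by (simp add: is_momentum_def)

lemma momentum_quadratic:
  assumes "h \<in> L2" "integrable lborel h" "Y \<in> sets borel"
  shows "ip h (P Y h) = complex_of_real (LINT y:Y|lborel. (cmod (fourier h y))\<^sup>2)"
  using P assms by (simp add: is_momentum_def)

lemma momentum_quadratic_ip:
  assumes "h \<in> L2" "integrable lborel h" "Y \<in> sets borel"
  shows "ip h (P Y h) = ip (position Y (fourier h)) (position Y (fourier h))"
  unfolding momentum_quadratic[OF assms] ip_self set_lebesgue_integral_def
  by (intro arg_cong[where f = complex_of_real] Bochner_Integration.integral_cong refl)
    (auto simp: position_def indicator_def)

text \<open>Polarisation of \<open>momentum_quadratic_ip\<close>: both sides are sesquilinear with
  the same diagonal.\<close>

lemma momentum_ip:
  assumes g: "g \<in> L2" "integrable lborel g" and h: "h \<in> L2" "integrable lborel h"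
    and Y: "Y \<in> sets borel" "bounded Y"
  shows "ip g (P Y h) = ip (position Y (fourier g)) (position Y (fourier h))"
proof -
  let ?u = "position Y (fourier g)" and ?v = "position Y (fourier h)"
  have op: "is_operator (P Y)" by (rule positive_opD(1)[OF povmD(1)[OF povm_momentum Y(1)]])
  have L: "?u \<in> L2" "?v \<in> L2" by (intro position_fourier_L2 Y g h)+
  have *: "b * ip g (P Y h) + cnj b * ip h (P Y g) = b * ip ?u ?v + cnj b * ip ?v ?u" for b
  proof -
    have "position Y (fourier (\<lambda>x. g x + b * h x)) = (\<lambda>x. ?u x + b * ?v x)"
      by (auto simp: position_def fourier_lincomb[OF g(2) h(2)] algebra_simps)
    moreover have "(\<lambda>x. g x + b * h x) \<in> L2" "integrable lborel (\<lambda>x. g x + b * h x)"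
      using L2_lincomb[OF g(1) h(1), of 1 b] g(2) h(2) by simp_all
    ultimately have "ip (\<lambda>x. g x + b * h x) (P Y (\<lambda>x. g x + b * h x)) =
        ip (\<lambda>x. ?u x + b * ?v x) (\<lambda>x. ?u x + b * ?v x)"
      using momentum_quadratic_ip[OF _ _ Y(1)] by simp
    then show ?thesis
      using ip_op_quad[OF op g(1) h(1), of b] ip_op_quad[OF positive_opD(1)[OF positive_op_id] L, of b]
        momentum_quadratic_ip[OF g Y(1)] momentum_quadratic_ip[OF h Y(1)]
      by simp
  qed
  \<comment> \<open>\<open>b = \<i>\<close> gives the difference of the two mixed terms, and
    \<open>b = 1\<close> their sum.\<close>
  have "\<i> * (ip g (P Y h) - ip h (P Y g)) = \<i> * (ip ?u ?v - ip ?v ?u)"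
    using *[of \<i>] by (simp add: algebra_simps)
  then have "ip g (P Y h) - ip h (P Y g) = ip ?u ?v - ip ?v ?u" by simp
  with *[of 1] show ?thesis by (simp add: complex_eq_iff)
qed

text \<open>The right-hand side is the inverse transform of the cut-off transform. Against a test
  vector \<open>g\<close>, the multiplication formula moves the transform from \<open>g\<close> to
  the other factor.\<close>

lemma momentum_eq_inverse_fourier:
  assumes h: "h \<in> L2" "integrable lborel h" and Y: "Y \<in> sets borel" "bounded Y"
  shows "ae_eq (P Y h) (\<lambda>x. cnj (fourier (\<lambda>y. cnj (position Y (fourier h) y)) x))"
proof -
  let ?u = "position Y (fourier h)"
  define k where "k = (\<lambda>x. cnj (fourier (\<lambda>y. cnj (?u y)) x))"
  have u: "?u \<in> L2" by (intro position_fourier_L2 Y h)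
  have "integrable lborel (position Y ?u)"
    by (intro L2_position_integrable Y u)
  also have "position Y ?u = ?u" by (auto simp: position_def indicator_def)
  finally have ui: "integrable lborel (\<lambda>y. cnj (?u y))" by simp
  have [measurable]: "?u \<in> borel_measurable borel" using u by measurable
  have [measurable]: "k \<in> borel_measurable borel" unfolding k_def by measurable
  have Ph: "P Y h \<in> L2" by (rule povm_op_L2[OF povm_momentum Y(1) h(1)])
  have test: "ip g (P Y h) = ip g k" if g: "g \<in> L2" "integrable lborel g" for g
  proof -
    have "ip g (P Y h) = ip (fourier g) (position Y ?u)"
      by (simp add: momentum_ip[OF g h Y] ip_position_left)
    also have "position Y ?u = ?u" by (auto simp: position_def indicator_def)
    also have "ip (fourier g) ?u = cnj (LINT y|lborel. fourier g y * cnj (?u y))"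
      unfolding ip_def by (subst Bochner_Integration.integral_cnj[symmetric]) simp
    also have "\<dots> = cnj (LINT x|lborel. g x * cnj (k x))"
      by (simp add: fourier_multiplication_formula[OF g(2) ui] k_def)
    also have "\<dots> = ip g k"
      unfolding ip_def by (subst Bochner_Integration.integral_cnj[symmetric]) simp
    finally show ?thesis .
  qed
  \<comment> \<open>\<open>k\<close> is bounded but not yet known to be in L2, so the comparison is
    made on bounded intervals, where the difference \<open>g\<close> is its own test vector.\<close>
  have "AE x in lborel. x \<in> {- real n..real n} \<longrightarrow> P Y h x = k x" for n
  proof -
    let ?I = "{- real n..real n}"
    let ?a = "position ?I (P Y h)" and ?b = "position ?I k"
    define g where "g = (\<lambda>x. ?a x - ?b x)"
    have a: "?a \<in> L2" by (rule position_L2[OF _ Ph]) simp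
    have b: "?b \<in> L2"
    proof (rule L2_bounded_support)
      show "?b \<in> borel_measurable borel" unfolding position_def by measurable
      fix x show "cmod (?b x) \<le> (LINT x|lborel. cmod (cnj (?u x))) / sqrt (2 * pi)"
        using fourier_bound[OF ui, of x]
        by (auto simp: position_def indicator_def k_def intro: order_trans[OF norm_ge_zero])
      show "bounded ?I" by simp
    qed (auto simp: position_def)
    have g: "g \<in> L2" unfolding g_def by (rule L2_diff[OF a b])
    have gI: "position ?I g = g" by (auto simp: g_def position_def indicator_def)
    have gi: "integrable lborel g"
      using L2_position_integrable[OF _ _ g, of ?I] by (simp add: gI)
    have "ip g g = ip g ?a - ip g ?b"
      using ip_lincomb_right[OF a b g, of 1 "-1"] by (simp add: g_def)
    also have "ip g ?a = ip g (P Y h)"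
      using ip_position_position[of ?I g "P Y h"] by (simp add: gI)
    also have "ip g ?b = ip g k"
      using ip_position_position[of ?I g k] by (simp add: gI)
    finally have "qform id g = 0"
      by (simp add: qform_def test[OF g gi])
    from qform_id_eq_0[OF g this] show ?thesis
      unfolding ae_eq_def by eventually_elim (auto simp: g_def position_def)
  qed
  then have "AE x in lborel. \<forall>n. x \<in> {- real n..real n} \<longrightarrow> P Y h x = k x"
    by (simp only: AE_all_countable) blast
  then have "AE x in lborel. P Y h x = k x"
  proof eventually_elim
    case (elim x)
    obtain n :: nat where "\<bar>x\<bar> \<le> real n" using real_arch_simple by blast
    then show ?case using elim[rule_format, of n] by (auto simp: abs_le_iff)
  qed
  then show ?thesis by (simp add: ae_eq_def k_def)
qed

text \<open>Up to conjugation \<open>P Y h\<close> is the transform of \<open>v\<close>, and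
  \<open>P UNIV = id\<close> makes the transform isometric at \<open>v\<close>. So the squared norm
  of \<open>P Y h\<close> is that of the cut-off transform of \<open>h\<close>: idempotence of
  \<open>P Y\<close> in terms of forms.\<close>

lemma momentum_norm:
  assumes h: "h \<in> L2" "integrable lborel h" and Y: "Y \<in> sets borel" "bounded Y"
  shows "qform id (P Y h) = qform (P Y) h"
proof -
  let ?u = "position Y (fourier h)"
  define v where "v = (\<lambda>y. cnj (?u y))"
  have u: "?u \<in> L2" by (intro position_fourier_L2 Y h)
  have [measurable]: "?u \<in> borel_measurable borel" using u by measurable
  have v: "v \<in> L2" by (rule L2_bounded_by[OF u]) (simp_all add: v_def)
  have vY: "position Y v = v" by (auto simp: v_def position_def indicator_def)
  have vi: "integrable lborel v" using L2_position_integrable[OF Y v] by (simp add: vY)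
  have Ph: "P Y h \<in> L2" by (rule povm_op_L2[OF povm_momentum Y(1) h(1)])
  have [measurable]: "v \<in> borel_measurable borel" "P Y h \<in> borel_measurable borel" using v Ph by measurable
  have "qform id (P Y h) = (LINT x|lborel. (cmod (fourier v x))\<^sup>2)"
    unfolding qform_id
  proof (rule integral_cong_AE)
    show "AE x in lborel. (cmod (P Y h x))\<^sup>2 = (cmod (fourier v x))\<^sup>2"
      using momentum_eq_inverse_fourier[OF h Y] unfolding ae_eq_def v_def[symmetric]
      by eventually_elim simp
  qed simp_all
  also have "complex_of_real \<dots> = ip v (P UNIV v)"
    using momentum_quadratic[OF v vi, of UNIV] by (simp add: set_lebesgue_integral_def)
  also have "\<dots> = ip v v"
    using povmD(2)[OF povm_momentum v] v povm_op_L2[OF povm_momentum _ v, of UNIV]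
    by (intro ip_cong) simp_all
  also have "\<dots> = ip ?u ?u"
    by (simp add: ip_self v_def)
  also have "\<dots> = ip h (P Y h)"
    by (rule momentum_quadratic_ip[OF h Y(1), symmetric])
  finally show ?thesis
    by (simp add: qform_def complex_eq_iff)
qed

text \<open>By symmetry and \<open>momentum_norm\<close> the form expands to
  \<open>qform (P Y) (P Y h) - qform (P Y) h\<close>, which \<open>P Y \<le> 1\<close> makes at most
  0. The Fourier formula is used only at \<open>h\<close>, since \<open>P Y h\<close> is not known
  to be integrable.\<close>

lemma momentum_complement:
  assumes h: "h \<in> L2" "integrable lborel h" and Y: "Y \<in> sets borel" "bounded Y"
  shows "qform (P Y) (\<lambda>x. h x - P Y h x) = 0"
proof -
  have pos: "positive_op (P Y)" by (rule povmD(1)[OF povm_momentum Y(1)])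
  have Ph: "P Y h \<in> L2" by (rule positive_opD(2)[OF pos h(1)])
  have "Re (ip h (P Y (P Y h))) = qform id (P Y h)"
    using positive_op_hermitian[OF pos Ph h(1)] by (simp add: qform_def)
  then have "qform (P Y) (\<lambda>x. h x - P Y h x) = qform (P Y) (P Y h) - qform (P Y) h"
    using qform_add[OF pos h(1) Ph, of "-1"] momentum_norm[OF assms] by simp
  also have "\<dots> \<le> 0"
    using povm_qform_le[OF povm_momentum Ph Y(1)] momentum_norm[OF assms] by simp
  finally show ?thesis
    using positive_opD(3)[OF pos L2_diff[OF h(1) Ph]] by linarith
qed

text \<open>The transform of \<open>position X f\<close> is bounded by its L1 norm over
  \<open>sqrt (2 * pi)\<close>, and Cauchy-Schwarz on \<open>X\<close> bounds that norm by the norm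
  of \<open>f\<close>. The squared bound is then integrated over \<open>Y\<close>.\<close>

lemma momentum_position_bound:
  assumes X: "X \<in> sets borel" "bounded X" and Y: "Y \<in> sets borel" "bounded Y" and f: "f \<in> L2"
  shows "qform (P Y) (position X f) \<le> measure lborel X * measure lborel Y / (2 * pi) * qform id f"
proof -
  have [measurable]: "X \<in> sets borel" "Y \<in> sets borel" by fact+
  have [measurable]: "f \<in> borel_measurable borel" using f by measurable
  let ?h = "position X f"
  have h: "?h \<in> L2" "integrable lborel ?h" by (intro position_L2 L2_position_integrable X f)+
  have [measurable]: "?h \<in> borel_measurable borel" using h by auto
  define C where "C = (LINT x|lborel. cmod (?h x))"
  have C: "C\<^sup>2 \<le> measure lborel X * qform id f"
  proof -
    let ?i = "indicator X :: vec" and ?f = "\<lambda>x. complex_of_real (cmod (f x))"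
    have i: "?i \<in> L2"
      by (rule L2_bounded_support[of _ X 1]) (use X in \<open>auto simp: indicator_def\<close>)
    have f': "?f \<in> L2" by (rule L2_bounded_by[OF f]) simp_all
    have "ip ?i ?f = (LINT x|lborel. complex_of_real (cmod (?h x)))"
      unfolding ip_def by (intro Bochner_Integration.integral_cong refl) (auto simp: position_def indicator_def)
    then have "Re (ip ?i (id ?f)) = C" by (simp add: C_def)
    moreover have "qform id ?i = measure lborel X"
    proof -
      have "qform id ?i = (LINT x|lborel. indicator X x)"
        unfolding qform_id by (intro Bochner_Integration.integral_cong refl) (auto simp: indicator_def)
      then show ?thesis by simp
    qed
    moreover have "qform id ?f = qform id f" by (simp add: qform_id)
    ultimately show ?thesis using qform_Cauchy_Schwarz[OF positive_op_id i f'] by simp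
  qed
  have fin: "emeasure lborel Y < \<infinity>" by (rule emeasure_bounded_finite[OF Y(2)])
  have bd: "(cmod (fourier ?h y))\<^sup>2 \<le> C\<^sup>2 / (2 * pi)" for y
  proof -
    have "(cmod (fourier ?h y))\<^sup>2 \<le> (C / sqrt (2 * pi))\<^sup>2"
      using fourier_bound[OF h(2), of y] unfolding C_def by (intro power_mono) simp_all
    then show ?thesis by (simp add: power_divide)
  qed
  have "qform (P Y) ?h = (LINT y:Y|lborel. (cmod (fourier ?h y))\<^sup>2)"
    using momentum_quadratic[OF h Y(1)] by (simp add: qform_def)
  also have "\<dots> \<le> (LINT y:Y|lborel. C\<^sup>2 / (2 * pi))"
  proof (rule set_integral_mono)
    show "set_integrable lborel Y (\<lambda>y. (cmod (fourier ?h y))\<^sup>2)"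
      unfolding set_integrable_def
      by (rule integrableI_bounded_set[of Y _ _ "C\<^sup>2 / (2 * pi)"]) (use fin bd in \<open>auto simp: indicator_def\<close>)
    show "set_integrable lborel Y (\<lambda>y. C\<^sup>2 / (2 * pi))"
      unfolding set_integrable_def
      by (rule integrableI_bounded_set[of Y _ _ "C\<^sup>2 / (2 * pi)"]) (use fin in \<open>auto simp: indicator_def\<close>)
  qed (rule bd)
  also have "\<dots> = measure lborel Y * (C\<^sup>2 / (2 * pi))"
    using fin by (subst set_integral_const) (auto simp: less_top)
  also have "\<dots> \<le> measure lborel Y * (measure lborel X * qform id f / (2 * pi))"
    using C by (intro mult_left_mono divide_right_mono) simp_all
  finally show ?thesis by (simp add: mult_ac)
qed

end

section \<open>Joint effects of small boxes\<close>

lemma qform_le_sqrt: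
  assumes "qform G g \<le> e * qform id g" "qform id g \<le> qform id f" "0 \<le> e"
  shows "sqrt (qform G g) \<le> sqrt e * sqrt (qform id f)"
  using assms by (metis mult_left_mono order_trans real_sqrt_le_mono real_sqrt_mult)

lemma qform_position_compl:
  assumes X: "X \<in> sets borel" and f: "f \<in> L2"
  shows "qform (position X) (\<lambda>x. f x - position X f x) = 0"
    and "qform id (\<lambda>x. f x - position X f x) \<le> qform id f"
    and "qform id (position X f) \<le> qform id f"
proof -
  show "qform (position X) (\<lambda>x. f x - position X f x) = 0"
    unfolding qform_position set_lebesgue_integral_def
    by (rule integral_eq_zero_AE) (auto simp: position_def indicator_def)
  note Qf = position_L2[OF X f]
  show "qform id (\<lambda>x. f x - position X f x) \<le> qform id f"
    unfolding qform_id
    by (intro integral_mono L2_integrable f L2_diff Qf) (auto simp: position_def indicator_def)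
  show "qform id (position X f) \<le> qform id f"
    unfolding qform_id
    by (intro integral_mono L2_integrable f Qf) (auto simp: position_def indicator_def)
qed

text \<open>The losses of \<open>2 * sqrt e\<close> at successive halvings of the norm sum to
  \<open>4 * sqrt e\<close>, and squaring gives \<open>16 * e\<close>.\<close>

lemma box_effect_small:
  assumes P: "is_momentum P" and G: "positive_op G"
    and X: "X \<in> sets borel" "bounded X" and Y: "Y \<in> sets borel" "bounded Y"
    and area: "measure lborel X * measure lborel Y \<le> pi / 2"
    and e: "0 \<le> e"
    and G1: "\<And>f. f \<in> L2 \<Longrightarrow> qform G f \<le> qform id f"
    and GQ: "\<And>f. f \<in> L2 \<Longrightarrow> qform G f \<le> qform (position X) f + e * qform id f"
    and GP: "\<And>f. f \<in> L2 \<Longrightarrow> qform G f \<le> qform (P Y) f + e * qform id f"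
    and f: "f \<in> L2"
  shows "qform G f \<le> 16 * e * qform id f"
proof -
  let ?N = "\<lambda>f. sqrt (qform id f)" and ?s = "\<lambda>f. sqrt (qform G f)"
  have pos: "positive_op (P Y)" by (rule povmD(1)[OF povm_momentum[OF P] Y(1)])
  have nn: "0 \<le> qform id f" if "f \<in> L2" for f by (rule positive_opD(3)[OF positive_op_id that])
  have step: "\<exists>g\<in>L2. ?N g \<le> ?N f / 2 \<and> ?s f \<le> ?s g + 2 * sqrt e * ?N f" if f: "f \<in> L2" for f
  proof -
    let ?h = "position X f"
    let ?g = "P Y ?h"
    have h: "?h \<in> L2" "integrable lborel ?h"
      by (rule position_L2[OF X(1) f], rule L2_position_integrable[OF X f])
    have g: "?g \<in> L2" by (rule positive_opD(2)[OF pos h(1)])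
    note d = L2_diff[OF f h(1)] L2_diff[OF h(1) g]
    have "?s f \<le> ?s (\<lambda>x. f x - ?h x) + ?s ?h"
      using qform_triangle[OF G d(1) h(1)] by simp
    moreover have "?s ?h \<le> ?s (\<lambda>x. ?h x - ?g x) + ?s ?g"
      using qform_triangle[OF G d(2) g] by simp
    moreover have "?s (\<lambda>x. f x - ?h x) \<le> sqrt e * ?N f"
      using GQ[OF d(1)] qform_position_compl[OF X(1) f] e by (intro qform_le_sqrt) simp_all
    moreover have "?s (\<lambda>x. ?h x - ?g x) \<le> sqrt e * ?N f"
    proof (rule qform_le_sqrt[OF _ _ e])
      \<comment> \<open>\<open>P Y\<close> does not see the part of \<open>?h\<close> outside
        \<open>?g\<close>, so only the noise term of \<open>GP\<close> remains.\<close>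
      show "qform G (\<lambda>x. ?h x - ?g x) \<le> e * qform id (\<lambda>x. ?h x - ?g x)"
        using GP[OF d(2)] momentum_complement[OF P h Y] by simp
      have "qform id (\<lambda>x. ?h x - ?g x) = qform id ?h - qform (P Y) ?h"
        using qform_add[OF positive_op_id h(1) g, of "-1"] momentum_norm[OF P h Y]
        by (simp add: qform_def)
      then show "qform id (\<lambda>x. ?h x - ?g x) \<le> qform id f"
        using positive_opD(3)[OF pos h(1)] qform_position_compl(3)[OF X(1) f] by simp
    qed
    moreover have "?N ?g \<le> ?N f / 2"
    proof -
      have "qform id ?g \<le> measure lborel X * measure lborel Y / (2 * pi) * qform id f"
        using momentum_norm[OF P h Y] momentum_position_bound[OF P X Y f] by simp
      \<comment> \<open>The area bound \<open>pi / 2\<close> over \<open>2 * pi\<close> is 1/4, so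
        the norm itself is halved.\<close>
      also have "\<dots> \<le> 1 / 4 * qform id f"
        using area nn[OF f] by (intro mult_right_mono) (simp_all add: field_simps)
      finally have "?N ?g \<le> sqrt (1 / 4 * qform id f)" by simp
      then show ?thesis by (simp add: real_sqrt_divide)
    qed
    ultimately show ?thesis using g by (intro bexI[of _ ?g]) auto
  qed
  define N where "N f = ?N f" for f
  \<comment> \<open>\<open>4 * sqrt e\<close> is the fixed point of the map taking \<open>c\<close>
    to \<open>c / 2 + 2 * sqrt e\<close>; the start of the induction is
    \<open>G \<le> 1\<close>.\<close>
  have iter: "?s f \<le> ((1 / 2) ^ n + 4 * sqrt e) * N f" if "f \<in> L2" for f n
    using that
  proof (induction n arbitrary: f)
    case 0
    have "?s f \<le> N f" using G1[OF 0] by (simp add: N_def)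
    also have "\<dots> \<le> (1 + 4 * sqrt e) * N f"
      using e nn[OF 0] by (simp add: N_def mult_le_cancel_right1)
    finally show ?case by simp
  next
    case (Suc n)
    obtain g where g: "g \<in> L2" "N g \<le> N f / 2" "?s f \<le> ?s g + 2 * sqrt e * N f"
      using step[OF Suc.prems] by (auto simp: N_def)
    have "((1 / 2) ^ n + 4 * sqrt e) * N g \<le> ((1 / 2) ^ n + 4 * sqrt e) * (N f / 2)"
      using g(2) e by (intro mult_left_mono) auto
    with Suc.IH[OF g(1)] g(3) show ?case by (simp add: algebra_simps)
  qed
  have "(\<lambda>n. ((1 / 2) ^ n + 4 * sqrt e) * ?N f) \<longlonglongrightarrow> (0 + 4 * sqrt e) * ?N f"
    by (intro tendsto_intros LIMSEQ_power_zero) simp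
  then have "?s f \<le> (0 + 4 * sqrt e) * ?N f"
    using iter[OF f] unfolding N_def by (intro LIMSEQ_le_const) auto
  then have "(?s f)\<^sup>2 \<le> (4 * sqrt e * ?N f)\<^sup>2"
    using positive_opD(3)[OF G f] by (intro power_mono) simp_all
  then show ?thesis
    using e nn[OF f] positive_opD(3)[OF G f] by (simp add: power_mult_distrib)
qed

section \<open>Travelling wave packets\<close>

text \<open>A unit vector located exactly in the interval of length 1 starting at \<open>a\<close>;
  the phase shifts its momentum distribution by \<open>b\<close>.\<close>

definition packet :: "real \<Rightarrow> real \<Rightarrow> vec" where
  "packet a b = (\<lambda>x. indicator {a..<a + 1} x * exp (\<i> * complex_of_real (b * x)))"

lemma packet_measurable [measurable]: "packet a b \<in> borel_measurable borel"
  unfolding packet_def by measurable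

lemma packet_L2: "packet a b \<in> L2"
  by (rule L2_bounded_support[of _ "{a..<a + 1}" 1]) (auto simp: packet_def norm_mult indicator_def)

lemma position_packet: "position {a..<a + 1} (packet a b) = packet a b"
  by (auto simp: packet_def position_def indicator_def)

lemma packet_integrable: "integrable lborel (packet a b)"
  using L2_position_integrable[OF _ _ packet_L2, of "{a..<a + 1}" a b] by (simp add: position_packet)

lemma packet_norm: "qform id (packet a b) = 1"
proof -
  have "qform id (packet a b) = (LINT x|lborel. indicator {a..<a + 1} x)"
    unfolding qform_id by (intro Bochner_Integration.integral_cong refl) (auto simp: packet_def norm_mult indicator_def)
  then show ?thesis by simp
qed

lemma qform_position_packet: "qform (position {a..<a + 1}) (packet a b) = 1"
  using packet_norm[of a b] by (simp add: qform_def position_packet)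

text \<open>Substituting \<open>a + x\<close> for \<open>x\<close> splits off
  \<open>exp (- \<i> * a * (y - b))\<close>, a factor of modulus 1.\<close>

lemma cmod_fourier_packet: "cmod (fourier (packet a b) y) = cmod (fourier (packet 0 0) (y - b))"
proof -
  have "(LINT x|lborel. exp (- \<i> * complex_of_real (x * y)) * packet a b x) =
      (LINT x|lborel. exp (- \<i> * complex_of_real ((a + 1 * x) * y)) * packet a b (a + 1 * x))"
    using lborel_integral_real_affine[of 1 "\<lambda>x. exp (- \<i> * complex_of_real (x * y)) * packet a b x" a] by simp
  also have "\<dots> = (LINT x|lborel. exp (- \<i> * complex_of_real (a * (y - b))) *
      (exp (- \<i> * complex_of_real (x * (y - b))) * packet 0 0 x))"
  proof (intro Bochner_Integration.integral_cong refl)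
    fix x
    have "exp (- \<i> * complex_of_real ((a + x) * y)) * exp (\<i> * complex_of_real (b * (a + x))) =
        exp (- \<i> * complex_of_real (a * (y - b))) * exp (- \<i> * complex_of_real (x * (y - b)))"
      unfolding exp_add[symmetric] by (rule arg_cong[where f = exp]) (simp add: algebra_simps)
    then show "exp (- \<i> * complex_of_real ((a + 1 * x) * y)) * packet a b (a + 1 * x) =
        exp (- \<i> * complex_of_real (a * (y - b))) * (exp (- \<i> * complex_of_real (x * (y - b))) * packet 0 0 x)"
      by (simp add: packet_def indicator_def)
  qed
  also have "\<dots> = exp (- \<i> * complex_of_real (a * (y - b))) *
      (LINT x|lborel. exp (- \<i> * complex_of_real (x * (y - b))) * packet 0 0 x)"
    by simp
  finally show ?thesis
    by (simp add: fourier_def norm_mult norm_divide)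
qed

lemma momentum_packet:
  assumes P: "is_momentum P"
  shows "qform (P {b - L..b + L}) (packet a b) = qform (P {- L..L}) (packet 0 0)"
proof -
  have *: "qform (P Y) (packet a b) = (LINT y|lborel. indicator Y y * (cmod (fourier (packet 0 0) (y - b)))\<^sup>2)"
    if "Y \<in> sets borel" for Y a b
    using momentum_quadratic[OF P packet_L2 packet_integrable that, of a b]
    by (simp add: qform_def set_lebesgue_integral_def cmod_fourier_packet[of a b])
  have "qform (P {b - L..b + L}) (packet a b) =
      (LINT y|lborel. indicator {b - L..b + L} (b + 1 * y) * (cmod (fourier (packet 0 0) (b + 1 * y - b)))\<^sup>2)"
    using lborel_integral_real_affine[of 1
        "\<lambda>y. indicator {b - L..b + L} y * (cmod (fourier (packet 0 0) (y - b)))\<^sup>2" b] *[of "{b - L..b + L}" a b]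
    by simp
  also have "\<dots> = (LINT y|lborel. indicator {- L..L} y * (cmod (fourier (packet 0 0) (y - 0)))\<^sup>2)"
    by (intro Bochner_Integration.integral_cong refl) (auto simp: indicator_def)
  finally show ?thesis using *[of "{- L..L}" 0 0] by simp
qed

text \<open>Continuity from below for the packet at the origin, carried to all others by
  \<open>momentum_packet\<close>. Uniformity in \<open>a\<close> and \<open>b\<close> allows the
  size of the box to be fixed before its place.\<close>

lemma momentum_packet_concentrated:
  assumes P: "is_momentum P" and "0 < d"
  shows "\<exists>n::nat. \<forall>a b. 1 - d \<le> qform (P {b - real n..b + real n}) (packet a b)"
proof -
  note E = povm_momentum[OF P]
  let ?M = "povm_measure borel P (packet 0 0)"
  interpret finite_measure ?M by (rule povm_measure(4)[OF E packet_L2])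
  have "(\<lambda>n. measure ?M {- real n..real n}) \<longlonglongrightarrow> measure ?M (\<Union>n. {- real n..real n})"
    by (rule finite_Lim_measure_incseq) (auto simp: povm_measure[OF E packet_L2] incseq_def)
  also have "(\<Union>n. {- real n..real n}) = UNIV"
  proof (intro equalityI subsetI)
    fix x :: real
    obtain n :: nat where "\<bar>x\<bar> \<le> real n" using real_arch_simple by blast
    then show "x \<in> (\<Union>n. {- real n..real n})" by (auto simp: abs_le_iff intro!: exI[of _ n])
  qed simp
  also have "measure ?M UNIV = 1"
    using povm_measure(5)[OF E packet_L2, of 0 0] by (simp add: packet_norm)
  finally have "eventually (\<lambda>n. 1 - d < measure ?M {- real n..real n}) sequentially"
    using \<open>0 < d\<close> by (intro order_tendstoD) auto
  then obtain n where "1 - d < measure ?M {- real n..real n}"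
    by (auto simp: eventually_sequentially)
  then have "1 - d \<le> qform (P {- real n..real n}) (packet 0 0)"
    by (simp add: povm_measure[OF E packet_L2])
  then show ?thesis using momentum_packet[OF P] by auto
qed

section \<open>Tails of the noise and the bound \<open>l + m \<le> 1\<close>\<close>

lemma finite_measure_tail:
  fixes \<nu> :: "real measure"
  assumes "finite_measure \<nu>" "sets \<nu> = sets borel" "0 < e"
  shows "\<exists>a. measure \<nu> {a..} < e"
proof -
  interpret finite_measure \<nu> by fact
  have "(\<lambda>n. measure \<nu> {real n..}) \<longlonglongrightarrow> measure \<nu> (\<Inter>n. {real n..})"
    by (rule finite_Lim_measure_decseq) (auto simp: assms(2) decseq_def)
  also have "(\<Inter>n. {real n..}) = {}"
  proof -
    have "\<exists>n. \<not> real n \<le> x" for x by (metis not_le reals_Archimedean2)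
    then show ?thesis by auto
  qed
  finally have "eventually (\<lambda>n. measure \<nu> {real n..} < e) sequentially"
    using \<open>0 < e\<close> by (intro order_tendstoD) auto
  then show ?thesis by (auto simp: eventually_sequentially)
qed

text \<open>\<open>S\<close> is kept apart from the mixture because a marginal of a joint observable
  agrees with it only up to \<open>op_eq\<close>.\<close>

lemma qform_noisy:
  assumes F: "povm M F" and X: "X \<in> sets M" and f: "f \<in> L2"
    and T: "prob_space \<nu>" "sets \<nu> = sets M" "T = (\<lambda>X f x. complex_of_real (measure \<nu> X) * f x)"
    and S: "op_eq S (obs_comb l F T X)" "is_operator S"
  shows "qform S f = l * qform (F X) f + (1 - l) * measure \<nu> X * qform id f"
proof -
  have povmT: "povm M T" using T by (intro povm_trivial) (auto simp: is_trivial_def)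
  have "ip f (S f) = ip f (obs_comb l F T X f)"
  proof (rule ip_cong)
    show "obs_comb l F T X f \<in> L2"
      unfolding obs_comb_def
      by (rule L2_lincomb[OF povm_op_L2[OF F X f] povm_op_L2[OF povmT X f]])
  qed (use S f in \<open>auto simp: op_eq_def intro: is_operatorD\<close>)
  also have "\<dots> = complex_of_real l * ip f (F X f) + complex_of_real (1 - l) * ip f (T X f)"
    by (rule obs_comb_ip[OF F povmT X f f])
  also have "ip f (T X f) = complex_of_real (measure \<nu> X) * ip f f"
    using ip_lincomb_right[OF f f f, of "complex_of_real (measure \<nu> X)" 0] by (simp add: T(3))
  finally show ?thesis by (simp add: qform_def ip_self)
qed

lemma JM_region_imp_sum_le_1:
  assumes P: "is_momentum P" and lm: "(l, m) \<in> JM_region borel borel position P"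
  shows "l + m \<le> 1"
proof (rule ccontr)
  define d where "d = l + m - 1"
  assume "\<not> l + m \<le> 1"
  then have d: "0 < d" by (simp add: d_def)
  have l: "0 \<le> l" "l \<le> 1" and m: "0 \<le> m" "m \<le> 1"
    using lm by (auto simp: JM_region_def)
  obtain T1 T2 where "is_trivial borel T1" "is_trivial borel T2"
    and jm: "jointly_measurable borel borel (obs_comb l position T1) (obs_comb m P T2)"
    using lm by (auto simp: JM_region_def)
  then obtain \<nu>1 \<nu>2 :: "real measure" where
    T1: "prob_space \<nu>1" "sets \<nu>1 = sets borel" "T1 = (\<lambda>X f x. complex_of_real (measure \<nu>1 X) * f x)" and
    T2: "prob_space \<nu>2" "sets \<nu>2 = sets borel" "T2 = (\<lambda>X f x. complex_of_real (measure \<nu>2 X) * f x)"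
    unfolding is_trivial_def by blast
  obtain E where E: "povm (borel \<Otimes>\<^sub>M borel) E"
    and E1: "\<And>X. X \<in> sets borel \<Longrightarrow> op_eq (E (X \<times> UNIV)) (obs_comb l position T1 X)"
    and E2: "\<And>Y. Y \<in> sets borel \<Longrightarrow> op_eq (E (UNIV \<times> Y)) (obs_comb m P T2 Y)"
    using jm unfolding jointly_measurable_def by auto
  have op: "is_operator (E (X \<times> Y))" if "X \<in> sets borel" "Y \<in> sets borel" for X Y
    using that by (intro positive_opD(1) povmD(1)[OF E]) simp
  have q1: "qform (E (X \<times> UNIV)) f = l * qform (position X) f + (1 - l) * measure \<nu>1 X * qform id f"
    if "X \<in> sets borel" "f \<in> L2" for X f
    using that by (intro qform_noisy[OF povm_position _ _ T1 E1 op]) auto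
  have q2: "qform (E (UNIV \<times> Y)) f = m * qform (P Y) f + (1 - m) * measure \<nu>2 Y * qform id f"
    if "Y \<in> sets borel" "f \<in> L2" for Y f
    using that by (intro qform_noisy[OF povm_momentum[OF P] _ _ T2 E2 op]) auto
  interpret nu1: prob_space \<nu>1 by (rule T1)
  interpret nu2: prob_space \<nu>2 by (rule T2)
  obtain n :: nat where n: "\<And>a b. 1 - d / 2 \<le> qform (P {b - real n..b + real n}) (packet a b)"
    using momentum_packet_concentrated[OF P, of "d / 2"] d by auto
  \<comment> \<open>Slices of size \<open>1 / N\<close> by \<open>2 * n\<close> have area below 1,
    hence below \<open>pi / 2\<close>; adding 1 keeps \<open>N\<close> positive when
    \<open>n = 0\<close>.\<close>
  define N where "N = 2 * n + 1"
  \<comment> \<open>Chosen so that \<open>N\<close> slices at \<open>16 * e\<close> each add up to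
    \<open>d / 4\<close>.\<close>
  define e where "e = d / (64 * real N)"
  have N: "0 < real N" by (simp add: N_def)
  have e: "0 < e" using d N by (simp add: e_def)
  \<comment> \<open>The box is moved towards plus infinity in both variables, so right tails of the
    noise are made small.\<close>
  obtain a where a: "measure \<nu>1 {a..} < e"
    using finite_measure_tail[OF nu1.finite_measure_axioms T1(2) e] by blast
  obtain c where c: "measure \<nu>2 {c..} < e"
    using finite_measure_tail[OF nu2.finite_measure_axioms T2(2) e] by blast
  \<comment> \<open>Centres the momentum window so that it starts exactly at
    \<open>c\<close>.\<close>
  define b where "b = c + real n"
  define X where "X = {a..<a + 1}"
  define Y where "Y = {b - real n..b + real n}"
  \<comment> \<open>Only the position side is cut. Shared endpoints are harmless, since the slices
    enter through subadditivity.\<close>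
  define J where "J i = {a + real i / real N..a + real (Suc i) / real N}" for i
  define \<psi> where "\<psi> = packet a b"
  have \<psi>: "\<psi> \<in> L2" "qform id \<psi> = 1" by (simp_all add: \<psi>_def packet_L2 packet_norm)
  have [simp]: "X \<in> sets borel" "Y \<in> sets borel" "J i \<in> sets borel" for i
    by (simp_all add: X_def Y_def J_def)
  have box: "qform (E (J i \<times> Y)) \<psi> \<le> 16 * e" for i
  proof -
    have "qform (E (J i \<times> Y)) \<psi> \<le> 16 * e * qform id \<psi>"
    proof (rule box_effect_small[OF P, of _ "J i" Y])
      show "positive_op (E (J i \<times> Y))" by (rule povmD(1)[OF E]) simp
      have J: "measure lborel (J i) = 1 / real N"
        using N by (simp add: J_def add_divide_distrib)
      have Y: "measure lborel Y = 2 * real n"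
        by (simp add: Y_def)
      have "2 * real n \<le> pi / 2 * real N"
        using pi_ge_two mult_right_mono[of 1 "pi / 2" "real N"] by (simp add: N_def)
      then show "measure lborel (J i) * measure lborel Y \<le> pi / 2"
        unfolding J Y using N by (simp add: field_simps)
      fix f assume f: "f \<in> L2"
      have nn: "0 \<le> qform id f" "0 \<le> qform (position (J i)) f" "0 \<le> qform (P Y) f"
        using f by (auto intro: positive_opD(3)[OF positive_op_id]
            positive_opD(3)[OF povmD(1)[OF povm_position]] positive_opD(3)[OF povmD(1)[OF povm_momentum[OF P]]])
      show "qform (E (J i \<times> Y)) f \<le> qform id f"
        by (rule povm_qform_le[OF E f]) simp
      have "measure \<nu>1 (J i) \<le> e"
      proof -
        have "J i \<subseteq> {a..}" by (auto simp: J_def intro: order_trans[of a "a + real i / real N"])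
        then show ?thesis using a nu1.finite_measure_mono[of "J i" "{a..}"] by (simp add: T1(2))
      qed
      then have "(1 - l) * measure \<nu>1 (J i) \<le> e"
        using l mult_mono[of "1 - l" 1 "measure \<nu>1 (J i)" e] by simp
      then have "(1 - l) * measure \<nu>1 (J i) * qform id f \<le> e * qform id f"
        using nn by (intro mult_right_mono) auto
      moreover have "l * qform (position (J i)) f \<le> qform (position (J i)) f"
        using l nn by (simp add: mult_left_le_one_le)
      moreover have "qform (E (J i \<times> Y)) f \<le> qform (E (J i \<times> UNIV)) f"
        by (rule povm_qform_mono[OF E f]) auto
      ultimately show "qform (E (J i \<times> Y)) f \<le> qform (position (J i)) f + e * qform id f"
        using q1[of "J i" f] f by simp
      have "measure \<nu>2 Y \<le> e"
      proof -
        have "Y \<subseteq> {c..}" by (auto simp: Y_def b_def)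
        then show ?thesis using c nu2.finite_measure_mono[of Y "{c..}"] by (simp add: T2(2))
      qed
      then have "(1 - m) * measure \<nu>2 Y \<le> e"
        using m mult_mono[of "1 - m" 1 "measure \<nu>2 Y" e] by simp
      then have "(1 - m) * measure \<nu>2 Y * qform id f \<le> e * qform id f"
        using nn by (intro mult_right_mono) auto
      moreover have "m * qform (P Y) f \<le> qform (P Y) f"
        using m nn by (simp add: mult_left_le_one_le)
      moreover have "qform (E (J i \<times> Y)) f \<le> qform (E (UNIV \<times> Y)) f"
        by (rule povm_qform_mono[OF E f]) auto
      ultimately show "qform (E (J i \<times> Y)) f \<le> qform (P Y) f + e * qform id f"
        using q2[of Y f] f by simp
    qed (use e \<psi> in \<open>auto simp: J_def Y_def\<close>)
    then show ?thesis by (simp add: \<psi>)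
  qed
  have cover: "X \<times> Y \<subseteq> (\<Union>i\<in>{..<N}. J i \<times> Y)"
  proof -
    have "\<exists>i<N. x \<in> J i" if "x \<in> X" for x
    proof (intro exI conjI)
      \<comment> \<open>The slice containing \<open>x\<close> is indexed by the integer part of
        \<open>t\<close>; \<open>t\<close> stays below \<open>N\<close> because \<open>X\<close> is
        half-open.\<close>
      define t where "t = (x - a) * real N"
      have t: "0 \<le> t" "t < real N" using that N by (auto simp: X_def t_def)
      have x: "x = a + t / real N" using N by (simp add: t_def)
      have fl: "real (nat \<lfloor>t\<rfloor>) \<le> t" "t \<le> real (Suc (nat \<lfloor>t\<rfloor>))"
        using t(1) by linarith+
      show "nat \<lfloor>t\<rfloor> < N" using fl(1) t(2) by linarith
      show "x \<in> J (nat \<lfloor>t\<rfloor>)"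
        using fl N unfolding J_def x by (auto intro!: divide_right_mono simp del: of_nat_Suc)
    qed
    then show ?thesis by auto
  qed
  have "qform (E (X \<times> Y)) \<psi> \<le> (\<Sum>i<N. qform (E (J i \<times> Y)) \<psi>)"
    by (rule povm_qform_subadditive[OF E \<psi>(1) _ _ _ cover]) auto
  also have "\<dots> \<le> (\<Sum>i<N. 16 * e)" by (rule sum_mono) (rule box)
  also have "\<dots> = d / 4" using N by (simp add: e_def)
  finally have XY: "qform (E (X \<times> Y)) \<psi> \<le> d / 4" .
  have "qform (E (X \<times> UNIV)) \<psi> + qform (E (UNIV \<times> Y)) \<psi> \<le> 1 + qform (E (X \<times> Y)) \<psi>"
    using povm_qform_incl_excl[OF E \<psi>(1), of "X \<times> UNIV" "UNIV \<times> Y"] by (simp add: \<psi> Times_Int_Times)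
  moreover have "l \<le> qform (E (X \<times> UNIV)) \<psi>"
    using q1[of X \<psi>] \<psi> l by (simp add: \<psi>_def X_def qform_position_packet)
  \<comment> \<open>The momentum of the packet misses \<open>Y\<close> with probability at most
    \<open>d / 2\<close>, and the noise term can only increase the effect.\<close>
  moreover have "m - d / 2 \<le> qform (E (UNIV \<times> Y)) \<psi>"
  proof -
    have "m * (1 - d / 2) \<le> m * qform (P Y) \<psi>"
      using n[of b a] m by (intro mult_left_mono) (simp_all add: \<psi>_def Y_def)
    moreover have "m * (d / 2) \<le> d / 2" using m d by (simp add: mult_left_le_one_le)
    moreover have "0 \<le> (1 - m) * measure \<nu>2 Y" using m by simp
    ultimately show ?thesis using q2[of Y \<psi>] \<psi> by (simp add: algebra_simps)
  qed
  \<comment> \<open>The losses \<open>d / 2\<close> from the momentum spread and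
    \<open>d / 4\<close> from the joint effect total less than the excess \<open>d\<close>.\<close>
  ultimately have "l + (m - d / 2) \<le> 1 + d / 4" using XY by linarith
  then have "d \<le> 3 / 4 * d" unfolding d_def by argo
  then show False using d by simp
qed

theorem theorem2:
  fixes P :: "real set \<Rightarrow> lop"
  assumes "is_momentum P"
  shows "JM_region (borel :: real measure) (borel :: real measure) position P =
           {(l, m). 0 \<le> l \<and> l \<le> 1 \<and> 0 \<le> m \<and> m \<le> 1 \<and> l + m \<le> 1}"
proof (intro equalityI subsetI)
  fix z assume "z \<in> JM_region borel borel position P"
  then show "z \<in> {(l, m). 0 \<le> l \<and> l \<le> 1 \<and> 0 \<le> m \<and> m \<le> 1 \<and> l + m \<le> 1}"
    using JM_region_imp_sum_le_1[OF assms] by (cases z) (auto simp: JM_region_def)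
next
  fix z assume "z \<in> {(l, m). 0 \<le> l \<and> l \<le> 1 \<and> 0 \<le> m \<and> m \<le> 1 \<and> l + m \<le> (1::real)}"
  then show "z \<in> JM_region borel borel position P"
    using JM_region_if_sum_le_1[OF povm_momentum[OF assms]] by auto
qed

end
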